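(* There exists a polycrystal $(\Omega,R_\ast)$ such that $\mathcal T_{\mathcal N}(R_\ast(\Omega))\subsetneq\mathcal F_{\mathcal M}(\Omega,R_\ast)$.
   Context: Notation: $e_1,e_2$ is the standard basis of $\mathbb R^2$, $|\cdot|$ the Euclidean norm, $$\mathcal M:=\{F\in\mathbb R^{2\times 2}:\det F=1,\ |Fe_1|=1\},\qquad \mathcal N:=\{F\in\mathbb R^{2\times 2}:\det F=1,\ |Fe_1|\leq 1\},$$ and for $R\in\mathrm{SO}(2)$, $\mathcal M R^T=\{FR^T:F\in\mathcal M\}$, $\mathcal N R^T=\{FR^T:F\in\mathcal N\}$. Polycrystal: a pair $(\Omega,R_\ast)$ such that $\Omega\subset\mathbb R^2$ is a bounded Lipschitz domain with a partition (up to a set of measure zero) into finitely many bounded Lipschitz domains $\Omega_1,\ldots,\Omega_N\subset\Omega$ (the grains), i.e. $\Omega=\mathrm{int}\bigcup_{k=1}^N\overline{\Omega}_k$ and $\mathrm{int}\,\overline{\Omega}_k=\Omega_k$ for all $k$; and $R_\ast:\Omega\to\mathrm{SO}(2)$ is constant on each $\Omega_k$, with $R_\ast|_{\Omega_k}\neq\pm R_\ast|_{\Omega_l}$ whenever $k\neq l$ and $\mathcal H^1(\partial\Omega_k\cap\partial\Omega_l)>0$ ($\mathcal H^1$ the one-dimensional Hausdorff measure). Taylor bound: $\mathcal T_{\mathcal N}(R_\ast(\Omega)):=\bigcap_{x\in\Omega}\mathcal N R_\ast^T(x)$, the finite intersection of the sets $\mathcal N R^T$ over all values $R$ attained by $R_\ast$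 on the grains (values on the null set between the grains are disregarded). Attainable macroscopic strains: $\mathcal F_{\mathcal M}(\Omega,R_\ast)$ is the set of all $F\in\mathbb R^{2\times 2}$ for which there is $u\in W^{1,\infty}(\Omega;\mathbb R^2)$ with $\nabla u(x)\in\mathcal M R_\ast^T(x)$ for a.e. $x\in\Omega$ and $u(x)=Fx$ for $x\in\partial\Omega$. *)

theory Defs
  imports "HOL-Analysis.Analysis"
begin

type_synonym mat2 = "real^2^2"

definition M_set :: "mat2 set" where
  "M_set = {F. det F = 1 \<and> norm (F *v axis 1 1) = 1}"

definition N_set :: "mat2 set" where
  "N_set = {F. det F = 1 \<and> norm (F *v axis 1 1) \<le> 1}"

definition rotated :: "mat2 set \<Rightarrow> mat2 \<Rightarrow> mat2 set" where
  "rotated S R = {F ** transpose R | F. F \<in> S}"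

text \<open>A bounded Lipschitz domain: a nonempty, bounded, open, connected set which, near each of its
  boundary points and in suitable Cartesian coordinates \<open>y = Q x\<close>, is the region strictly above the
  graph of a Lipschitz function.\<close>

definition bounded_lipschitz_domain :: "(real^2) set \<Rightarrow> bool" where
  "bounded_lipschitz_domain D \<longleftrightarrow>
     D \<noteq> {} \<and> open D \<and> connected D \<and> bounded D \<and>
     (\<forall>p \<in> frontier D. \<exists>r>0. \<exists>Q :: mat2. \<exists>L. \<exists>\<gamma> :: real \<Rightarrow> real.
        orthogonal_matrix Q \<and> L-lipschitz_on UNIV \<gamma> \<and>
        D \<inter> ball p r = {x \<in> ball p r. (Q *v x) $ 2 > \<gamma> ((Q *v x) $ 1)})"

text \<open>One-dimensional Hausdorff measure, normalised to agree with length. Boundedness of the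
  covering sets is required because \<^term>\<open>diameter C\<close> is meaningless for unbounded \<open>C\<close>.\<close>

definition hausdorff1_pre :: "real \<Rightarrow> 'a::metric_space set \<Rightarrow> ennreal" where
  "hausdorff1_pre \<delta> A =
     (INF C \<in> {C :: nat \<Rightarrow> 'a set. A \<subseteq> (\<Union>i. C i) \<and> (\<forall>i. bounded (C i) \<and> diameter (C i) \<le> \<delta>)}.
        \<Sum>i. ennreal (diameter (C i)))"

definition hausdorff1 :: "'a::metric_space set \<Rightarrow> ennreal" where
  "hausdorff1 A = (SUP \<delta> \<in> {0<..}. hausdorff1_pre \<delta> A)"

text \<open>The polycrystal is the pair \<open>(\<Omega>, R)\<close>; the number of grains \<open>N\<close> and the grains
  \<open>G 1, \<dots>, G N\<close> are carried along explicitly. Only the values of \<open>R\<close> on \<open>\<Omega>\<close> are meaningful.\<close>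

definition polycrystal ::
  "nat \<Rightarrow> (nat \<Rightarrow> (real^2) set) \<Rightarrow> (real^2) set \<Rightarrow> (real^2 \<Rightarrow> mat2) \<Rightarrow> bool" where
  "polycrystal N G \<Omega> R \<longleftrightarrow>
     bounded_lipschitz_domain \<Omega> \<and>
     (\<forall>k\<in>{1..N}. bounded_lipschitz_domain (G k) \<and> G k \<subseteq> \<Omega> \<and> interior (closure (G k)) = G k) \<and>
     disjoint_family_on G {1..N} \<and>
     negligible (\<Omega> - (\<Union>k\<in>{1..N}. G k)) \<and>
     \<Omega> = interior (\<Union>k\<in>{1..N}. closure (G k)) \<and>
     (\<forall>x\<in>\<Omega>. rotation_matrix (R x)) \<and>
     (\<forall>k\<in>{1..N}. R constant_on G k) \<and>
     (\<forall>k\<in>{1..N}. \<forall>l\<in>{1..N}.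
        k \<noteq> l \<and> hausdorff1 (frontier (G k) \<inter> frontier (G l)) > 0 \<longrightarrow>
        (\<forall>x\<in>G k. \<forall>y\<in>G l. R x \<noteq> R y \<and> R x \<noteq> - R y))"

definition taylor_N :: "nat \<Rightarrow> (nat \<Rightarrow> (real^2) set) \<Rightarrow> (real^2 \<Rightarrow> mat2) \<Rightarrow> mat2 set" where
  "taylor_N N G R = (\<Inter>k\<in>{1..N}. \<Inter>x\<in>G k. rotated N_set (R x))"

primrec C_k :: "nat \<Rightarrow> ('a::euclidean_space \<Rightarrow> real) \<Rightarrow> bool" where
  "C_k 0 f \<longleftrightarrow> continuous_on UNIV f"
| "C_k (Suc k) f \<longleftrightarrow>
     (\<forall>x. f differentiable (at x)) \<and> (\<forall>v. C_k k (\<lambda>x. frechet_derivative f (at x) v))"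

definition test_function :: "'a::euclidean_space set \<Rightarrow> ('a \<Rightarrow> real) \<Rightarrow> bool" where
  "test_function D \<phi> \<longleftrightarrow>
     (\<forall>k. C_k k \<phi>) \<and> compact (closure {x. \<phi> x \<noteq> 0}) \<and> closure {x. \<phi> x \<noteq> 0} \<subseteq> D"

definition locally_integrable ::
  "'a::euclidean_space set \<Rightarrow> ('a \<Rightarrow> 'b::euclidean_space) \<Rightarrow> bool" where
  "locally_integrable D f \<longleftrightarrow> (\<forall>K. compact K \<and> K \<subseteq> D \<longrightarrow> set_integrable lebesgue K f)"

text \<open>The entry \<open>G x $ i $ j\<close> is the weak partial derivative in direction \<open>j\<close> of the
  component \<open>u x $ i\<close>.\<close>

definition has_weak_gradient :: "(real^2) set \<Rightarrow> (real^2 \<Rightarrow> real^2) \<Rightarrow> (real^2 \<Rightarrow> mat2) \<Rightarrow> bool" where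
  "has_weak_gradient D u G \<longleftrightarrow>
     locally_integrable D u \<and> locally_integrable D G \<and>
     (\<forall>\<phi>. test_function D \<phi> \<longrightarrow> (\<forall>i j.
        (LINT x:D|lebesgue. u x $ i * frechet_derivative \<phi> (at x) (axis j 1)) =
        - (LINT x:D|lebesgue. G x $ i $ j * \<phi> x)))"

definition L_infinity :: "(real^2) set \<Rightarrow> (real^2 \<Rightarrow> 'b::euclidean_space) set" where
  "L_infinity D =
     {f. f \<in> borel_measurable (lebesgue_on D) \<and> (\<exists>C. AE x in lebesgue_on D. norm (f x) \<le> C)}"

definition W1_infinity :: "(real^2) set \<Rightarrow> (real^2 \<Rightarrow> real^2) set" where
  "W1_infinity D = {u \<in> L_infinity D. \<exists>G \<in> L_infinity D. has_weak_gradient D u G}"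

text \<open>The boundary condition refers to the representative of \<open>u\<close> that is continuous up to the
  boundary, which exists for every \<open>W\<^sup>1\<^sup>,\<^sup>\<infinity>\<close> function on a bounded Lipschitz domain.\<close>

definition attainable_M :: "(real^2) set \<Rightarrow> (real^2 \<Rightarrow> mat2) \<Rightarrow> mat2 set" where
  "attainable_M \<Omega> R =
     {F. \<exists>u \<in> W1_infinity \<Omega>. continuous_on (closure \<Omega>) u \<and>
        (\<exists>G. has_weak_gradient \<Omega> u G \<and> (AE x in lebesgue_on \<Omega>. G x \<in> rotated M_set (R x))) \<and>
        (\<forall>x \<in> frontier \<Omega>. u x = F *v x)}"

end

theory Submission
  imports Defs
begin

text \<open>Idea. Take a triangle \<open>A\<^sub>0 A\<^sub>1 A\<^sub>2\<close>, in it points \<open>B\<^sub>0, B\<^sub>1, B\<^sub>2\<close> whose barycentric coordinates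
  \<open>(a, b, c), (c, a, b), (b, c, a)\<close> are cyclic shifts of each other, and triangulate by the \<open>B\<^sub>i\<close>. Keeping
  the \<open>A\<^sub>i\<close> fixed and swapping two coordinates, \<open>(b, a, c), (c, b, a), (a, c, b)\<close>, changes none of the
  seven areas (the configuration twists). Followed by a shear this is a piecewise affine area-preserving
  map whose boundary values are those of the shear. Every matrix of determinant \<open>1\<close> preserves the length
  of some unit vector, so each of the seven triangles becomes a grain once its slip direction is chosen as
  such a vector, and the shear is attained exactly. For \<open>(a, b, c) = (2, 3, 1)/6\<close> two of the seven
  gradients are rotations, so that their slip directions are free and can be chosen orthogonal; this
  reduces the Taylor bound to the rotations, which are attained by rigid motions.\<close>

section \<open>Convex domains are Lipschitz\<close>

text \<open>At a boundary point \<open>p\<close> the axis \<open>e\<close> points to the centre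
  \<open>z\<close> of a ball inside \<open>D\<close>. Convexity then gives a uniform cone condition:
  near \<open>p\<close>, the upward cone of slope \<open>L\<close> over any point of
  \<open>D\<close> stays in \<open>D\<close>. Hence \<open>D\<close> is locally the region above the
  lower envelope of these cones.\<close>

lemma bounded_lipschitz_domain_convex:
  fixes D :: "(real^2) set"
  assumes "open D" "convex D" "bounded D" "D \<noteq> {}"
  shows "bounded_lipschitz_domain D"
  unfolding bounded_lipschitz_domain_def
proof (intro conjI ballI)
  show "connected D" using assms(2) by (rule convex_connected)
  fix p assume p: "p \<in> frontier D"
  have pc: "p \<in> closure D" and pn: "p \<notin> D"
    using p \<open>open D\<close> by (auto simp: frontier_def interior_open)
  obtain z where "z \<in> D" using assms(4) by blast
  then obtain \<rho> where \<rho>: "\<rho> > 0" "ball z \<rho> \<subseteq> D" using \<open>open D\<close> openE by blast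
  define d where "d = norm (z - p)"
  have d\<rho>: "d \<ge> \<rho>"
    using pn \<rho>(2) by (force simp: d_def dist_norm subset_iff)
  have d0: "d > 0" using d\<rho> \<rho>(1) by simp
  define e where "e = (z - p) /\<^sub>R d"
  have e1: "norm e = 1" using d0 by (simp add: e_def d_def)
  have e1': "(e$1)^2 + (e$2)^2 = 1"
    using e1 by (simp add: norm_eq_1 inner_vec_def sum_2 power2_eq_square)
  define f :: "real^2" where "f = vector [e$2, - e$1]"
  have f1: "norm f = 1"
    using e1' by (simp add: f_def norm_eq_1 inner_vec_def sum_2 power2_eq_square)
  define s where "s = (\<lambda>x::real^2. f \<bullet> x)"
  define t where "t = (\<lambda>x::real^2. e \<bullet> x)"
  define Q :: mat2 where "Q = vector [f, e]"
  have Q: "(Q *v x) $ 1 = s x" "(Q *v x) $ 2 = t x" for x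
    by (simp_all add: Q_def s_def t_def matrix_vector_mult_def inner_vec_def)
  have orthQ: "orthogonal_matrix Q"
    unfolding orthogonal_matrix
    using e1' by (simp add: Q_def f_def vec_eq_iff forall_2 matrix_matrix_mult_def transpose_def
        mat_def sum_2 power2_eq_square algebra_simps)
  have st: "x = s x *\<^sub>R f + t x *\<^sub>R e" for x
  proof -
    have "s x * e$2 + t x * e$1 = ((e$1)^2 + (e$2)^2) * x$1"
         "- (s x * e$1) + t x * e$2 = ((e$1)^2 + (e$2)^2) * x$2"
      by (simp_all add: s_def t_def f_def inner_vec_def sum_2 power2_eq_square algebra_simps)
    then show ?thesis using e1' by (simp add: vec_eq_iff forall_2 f_def)
  qed
  have t_le: "\<bar>t x\<bar> \<le> norm x" for x
    using Cauchy_Schwarz_ineq2[of e x] e1 by (simp add: t_def)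
  have s_diff: "s (x - y) = s x - s y" and t_diff: "t (x - y) = t x - t y" for x y
    by (simp_all add: s_def t_def inner_diff_right)
  have se: "s e = 0" "t e = 1"
    using e1 by (simp_all add: s_def t_def f_def inner_vec_def sum_2 norm_eq_1)
  \<comment> \<open>The constants satisfy \<open>d / L = r\<close> and
    \<open>2 * r = \<rho> \<le> d\<close>. The first bounds the sideways shift \<open>h\<close>
    below by \<open>r\<close>, the second gives both \<open>\<tau> < 1\<close> and room for
    \<open>w\<close> in the ball about \<open>z\<close>.\<close>
  define L where "L = 2 * d / \<rho>"
  define r where "r = \<rho> / 2"
  have L0: "L > 0" and r0: "r > 0" using d0 \<rho>(1) by (simp_all add: L_def r_def)
  have cone: "y \<in> D" if x: "x \<in> D" "x \<in> ball p r" and y: "y \<in> ball p r"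
    and xy: "t y - t x > L * \<bar>s y - s x\<bar>" for x y
  proof -
    define \<tau> where "\<tau> = (t y - t x) / d"
    have "t y - t x > 0" using xy L0
      by (metis abs_ge_zero less_le_not_le order_trans mult_nonneg_nonneg not_less)
    then have \<tau>0: "\<tau> > 0" using d0 by (simp add: \<tau>_def)
    have "t y - t x \<le> norm (y - x)" using t_le[of "y - x"] by (simp add: t_diff)
    also have "\<dots> \<le> dist p x + dist p y"
      by (metis dist_commute dist_norm dist_triangle)
    also have "\<dots> < d" using x y d\<rho> by (simp add: r_def)
    finally have \<tau>1: "\<tau> < 1" using d0 by (simp add: \<tau>_def)
    define h where "h = (s y - s x) / \<tau>"
    \<comment> \<open>The ray from \<open>x\<close> through \<open>y\<close> is prolonged until it
      has gained height \<open>d\<close>. As \<open>z\<close> lies at height \<open>d\<close>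
      straight above \<open>p\<close>, \<open>w - z\<close> differs from \<open>x - p\<close> only
      by the sideways shift.\<close>
    define w where "w = x + h *\<^sub>R f + d *\<^sub>R e"
    have "L * \<bar>s y - s x\<bar> < \<tau> * d" using xy d0 by (simp add: \<tau>_def)
    then have "\<bar>h\<bar> < d / L" using \<tau>0 L0 by (simp add: h_def field_simps)
    then have hr: "\<bar>h\<bar> < r" using d0 \<rho>(1) by (simp add: L_def r_def)
    have "w - z = (x - p) + h *\<^sub>R f" using d0 by (simp add: w_def e_def)
    then have "norm (w - z) \<le> norm (x - p) + \<bar>h\<bar>"
      by (metis norm_triangle_ineq norm_scaleR f1 mult.right_neutral)
    also have "\<dots> < \<rho>" using hr x(2) by (simp add: r_def dist_norm norm_minus_commute)
    finally have "w \<in> D" using \<rho>(2) by (auto simp: dist_norm norm_minus_commute)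
    moreover have "y = (1 - \<tau>) *\<^sub>R x + \<tau> *\<^sub>R w"
    proof -
      have \<tau>d: "\<tau> * d = t y - t x" using d0 by (simp add: \<tau>_def)
      have "y - x = \<tau> *\<^sub>R (h *\<^sub>R f + d *\<^sub>R e)"
        using st[of "y - x"] \<tau>0 \<tau>d by (simp add: s_diff t_diff h_def scaleR_add_right)
      then show ?thesis by (simp add: w_def algebra_simps)
    qed
    ultimately show ?thesis using x(1) \<tau>0 \<tau>1 \<open>convex D\<close> by (simp add: convex_alt)
  qed
  define X where "X = D \<inter> ball p r"
  have Xne: "X \<noteq> {}"
    using pc r0 unfolding X_def closure_approachable by (force simp: dist_commute)
  \<comment> \<open>Each function under the infimum is \<open>L\<close>-Lipschitz in
    \<open>\<sigma>\<close>: its graph is the boundary of the cone with apex at a point of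
    \<open>X\<close>. The infimum inherits the constant.\<close>
  define \<gamma> where "\<gamma> = (\<lambda>\<sigma>. INF x\<in>X. t x + L * \<bar>\<sigma> - s x\<bar>)"
  have bdd: "bdd_below ((\<lambda>x. t x + L * \<bar>\<sigma> - s x\<bar>) ` X)" for \<sigma>
  proof (rule bdd_belowI2)
    fix x assume "x \<in> X"
    then have "t p - t x < r" using t_le[of "p - x"] by (auto simp: X_def t_diff dist_norm)
    moreover have "L * \<bar>\<sigma> - s x\<bar> \<ge> 0" using L0 by simp
    ultimately show "t p - r \<le> t x + L * \<bar>\<sigma> - s x\<bar>" by linarith
  qed
  have \<gamma>le: "\<gamma> \<sigma> \<le> t x + L * \<bar>\<sigma> - s x\<bar>" if "x \<in> X" for \<sigma> x
    unfolding \<gamma>_def by (rule cINF_lower[OF bdd that])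
  have lip1: "\<gamma> \<sigma> \<le> \<gamma> \<sigma>' + L * \<bar>\<sigma> - \<sigma>'\<bar>" for \<sigma> \<sigma>'
  proof -
    have "\<gamma> \<sigma> - L * \<bar>\<sigma> - \<sigma>'\<bar> \<le> t x + L * \<bar>\<sigma>' - s x\<bar>" if "x \<in> X" for x
    proof -
      have "L * \<bar>\<sigma> - s x\<bar> \<le> L * (\<bar>\<sigma> - \<sigma>'\<bar> + \<bar>\<sigma>' - s x\<bar>)"
        using L0 by (intro mult_left_mono) auto
      then show ?thesis using \<gamma>le[OF that, of \<sigma>] by (simp add: algebra_simps)
    qed
    then have "\<gamma> \<sigma> - L * \<bar>\<sigma> - \<sigma>'\<bar> \<le> \<gamma> \<sigma>'"
      unfolding \<gamma>_def[of] by (intro cINF_greatest Xne) (auto simp: \<gamma>_def)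
    then show ?thesis by simp
  qed
  have lip: "L-lipschitz_on UNIV \<gamma>"
  proof (rule lipschitz_onI)
    fix \<sigma> \<sigma>'
    show "dist (\<gamma> \<sigma>) (\<gamma> \<sigma>') \<le> L * dist \<sigma> \<sigma>'"
      using lip1[of \<sigma> \<sigma>'] lip1[of \<sigma>' \<sigma>] by (simp add: dist_real_def abs_minus_commute abs_le_iff)
  qed (use L0 in simp)
  have "x \<in> D \<longleftrightarrow> t x > \<gamma> (s x)" if x: "x \<in> ball p r" for x
  proof
    assume "x \<in> D"
    then have "x \<in> X" "open X" using x \<open>open D\<close> by (auto simp: X_def)
    then obtain \<epsilon> where \<epsilon>: "\<epsilon> > 0" "cball x \<epsilon> \<subseteq> X" using open_contains_cball by blast
    \<comment> \<open>Openness yields the strict inequality: the cone with apex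
      \<open>\<epsilon>\<close> below \<open>x\<close> has height \<open>t x - \<epsilon>\<close>
      over \<open>s x\<close>.\<close>
    have "x - \<epsilon> *\<^sub>R e \<in> X" using \<epsilon> e1 by (auto simp: dist_norm subset_iff)
    from \<gamma>le[OF this, of "s x"] show "t x > \<gamma> (s x)"
      using \<epsilon>(1) se by (simp add: s_diff t_diff) (simp add: s_def t_def se[unfolded s_def t_def])
  next
    assume "t x > \<gamma> (s x)"
    then obtain y where "y \<in> X" "t y + L * \<bar>s x - s y\<bar> < t x"
      unfolding \<gamma>_def by (subst (asm) cINF_less_iff[OF Xne bdd]) blast
    then show "x \<in> D" using cone[of y x] x by (auto simp: X_def)
  qed
  then show "\<exists>r>0. \<exists>Q :: mat2. \<exists>L. \<exists>\<gamma> :: real \<Rightarrow> real.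
        orthogonal_matrix Q \<and> L-lipschitz_on UNIV \<gamma> \<and>
        D \<inter> ball p r = {x \<in> ball p r. (Q *v x) $ 2 > \<gamma> ((Q *v x) $ 1)}"
    using r0 orthQ lip by (intro exI[of _ r] conjI exI[of _ Q] exI[of _ L] exI[of _ \<gamma>])
      (auto simp: Q)
qed (use assms in auto)

section \<open>Weak gradients of Lipschitz maps\<close>

lemma test_functionD:
  assumes "test_function D \<phi>"
  shows "continuous_on UNIV \<phi>"
    and "(\<phi> has_derivative frechet_derivative \<phi> (at x)) (at x)"
    and "continuous_on UNIV (\<lambda>x. frechet_derivative \<phi> (at x) v)"
    and "frechet_derivative \<phi> (at x) v \<noteq> 0 \<Longrightarrow> x \<in> closure {x. \<phi> x \<noteq> 0}"
proof -
  have C: "C_k (Suc 0) \<phi>" "C_k 0 \<phi>" using assms unfolding test_function_def by blast+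
  then show "continuous_on UNIV \<phi>" "continuous_on UNIV (\<lambda>x. frechet_derivative \<phi> (at x) v)"
    by simp_all
  show d: "(\<phi> has_derivative frechet_derivative \<phi> (at x)) (at x)"
    using C(1) frechet_derivative_works by auto
  assume nz: "frechet_derivative \<phi> (at x) v \<noteq> 0"
  show "x \<in> closure {x. \<phi> x \<noteq> 0}"
  proof (rule ccontr)
    assume x: "x \<notin> closure {x. \<phi> x \<noteq> 0}"
    have z: "0 = \<phi> y" if "y \<in> - closure {x. \<phi> x \<noteq> 0}" for y
    proof (rule ccontr)
      assume "0 \<noteq> \<phi> y"
      then have "y \<in> {x. \<phi> x \<noteq> 0}" by simp
      from subsetD[OF closure_subset this] that show False by (simp only: Compl_iff not_True_eq_False)
    qed
    have "(\<phi> has_derivative (\<lambda>_. 0)) (at x)"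
    proof (rule has_derivative_transform_within_open)
      show "((\<lambda>_. 0 :: real) has_derivative (\<lambda>_. 0)) (at x)" by simp
      show "open (- closure {x. \<phi> x \<noteq> 0})" by (intro open_Compl closed_closure)
      show "x \<in> - closure {x. \<phi> x \<noteq> 0}" unfolding Compl_iff by (rule x)
    qed (rule z)
    from has_derivative_unique[OF d this] show False using nz by simp
  qed
qed

section \<open>Integrals of functions with bounded support\<close>

lemma continuous_bounded_if_compact_support:
  fixes f :: "'a::euclidean_space \<Rightarrow> real"
  assumes "continuous_on UNIV f" "compact K" "\<And>x. f x \<noteq> 0 \<Longrightarrow> x \<in> K"
  obtains M where "M \<ge> 0" "\<And>x. \<bar>f x\<bar> \<le> M"
proof -
  have "bounded (f ` K)"
    by (intro compact_imp_bounded compact_continuous_image continuous_on_subset[OF assms(1)] assms(2)) simp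
  then obtain M where M: "\<And>x. x \<in> K \<Longrightarrow> \<bar>f x\<bar> \<le> M" by (auto simp: bounded_real)
  have "\<bar>f x\<bar> \<le> max M 0" for x
    using M[of x] assms(3)[of x] by (cases "f x = 0") auto
  then show ?thesis by (intro that[of "max M 0"]) auto
qed

lemma integrable_lborel_bounded_support:
  fixes f :: "'a::euclidean_space \<Rightarrow> 'b::{banach, second_countable_topology}"
  assumes "f \<in> borel_measurable borel" "\<And>x. norm (f x) \<le> W" "bounded K" "\<And>x. f x \<noteq> 0 \<Longrightarrow> x \<in> K"
  shows "integrable lborel f"
proof -
  obtain a b where "K \<subseteq> cbox a b" using bounded_subset_cbox_symmetric[OF assms(3)] by blast
  then show ?thesis
    using assms emeasure_lborel_cbox_finite[of a b]
    by (intro integrableI_bounded_set[of "cbox a b" _ _ W]) auto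
qed

lemma integral_lborel_translate:
  fixes f :: "'a::euclidean_space \<Rightarrow> 'b::{banach, second_countable_topology}"
  assumes "f \<in> borel_measurable borel"
  shows "(\<integral>x. f (x + c) \<partial>lborel) = (\<integral>x. f x \<partial>lborel)"
proof -
  have "(\<integral>x. f x \<partial>lborel) = (\<integral>x. f x \<partial>distr lborel borel ((+) c))"
    by (simp add: lborel_distr_plus)
  also have "\<dots> = (\<integral>x. f (c + x) \<partial>lborel)" using assms by (intro integral_distr) auto
  finally show ?thesis by (simp add: add.commute)
qed

lemma locally_integrable_bounded_on_compact:
  assumes f: "f \<in> borel_measurable borel" and "\<And>K. compact K \<Longrightarrow> K \<subseteq> D \<Longrightarrow> bounded (f ` K)"
  shows "locally_integrable D f"
  unfolding locally_integrable_def set_integrable_def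
proof (intro allI impI)
  fix K assume K: "compact K \<and> K \<subseteq> D"
  then obtain W where W: "\<And>x. x \<in> K \<Longrightarrow> norm (f x) \<le> W"
    using assms(2)[of K] by (auto simp: bounded_iff)
  have [measurable]: "K \<in> sets borel" using K by (auto intro: borel_compact)
  have "integrable lborel (\<lambda>x. indicator K x *\<^sub>R f x)"
  proof (rule integrable_lborel_bounded_support[where W = "max W 0" and K = K])
    show "norm (indicator K x *\<^sub>R f x) \<le> max W 0" for x
      using W[of x] by (auto simp: indicator_def)
  qed (use f K in \<open>auto simp: compact_imp_bounded indicator_def split: if_splits\<close>)
  then show "integrable lebesgue (\<lambda>x. indicator K x *\<^sub>R f x)"
    using f by (subst integrable_completion) auto
qed

text \<open>The integral of a translate does not depend on the translation, so the difference quotients of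
  the product of a component of \<open>u\<close> with a test function have integral \<open>0\<close>; the Lipschitz bound
  allows passing to the limit by dominated convergence.\<close>
lemma has_weak_gradient_lipschitz:
  fixes u :: "real^2 \<Rightarrow> real^2" and H :: "real^2 \<Rightarrow> mat2"
  assumes "open D" and lip: "L-lipschitz_on UNIV u"
    and H[measurable]: "H \<in> borel_measurable borel" and HC: "\<And>x. norm (H x) \<le> C"
    and deriv: "AE x in lborel. x \<in> D \<longrightarrow> (u has_derivative (\<lambda>h. H x *v h)) (at x)"
  shows "has_weak_gradient D u H"
  unfolding has_weak_gradient_def
proof (intro conjI allI impI)
  have contu: "continuous_on UNIV u" using lip by (rule lipschitz_on_continuous_on)
  then have u[measurable]: "u \<in> borel_measurable borel" by (rule borel_measurable_continuous_onI)
  show "locally_integrable D u"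
    by (rule locally_integrable_bounded_on_compact[OF u])
      (meson compact_continuous_image compact_imp_bounded contu continuous_on_subset subset_UNIV)
  show "locally_integrable D H"
    by (rule locally_integrable_bounded_on_compact[OF H]) (use HC in \<open>auto simp: bounded_iff\<close>)
  fix \<phi> :: "real^2 \<Rightarrow> real" and i j :: 2
  assume \<phi>: "test_function D \<phi>"
  define K where "K = closure {x. \<phi> x \<noteq> 0}"
  have K: "compact K" "K \<subseteq> D" using \<phi> by (auto simp: K_def test_function_def)
  define e :: "real^2" where "e = axis j 1"
  define \<psi> where "\<psi> = (\<lambda>x. frechet_derivative \<phi> (at x) e)"
  note D = test_functionD[OF \<phi>]
  have e1: "norm e = 1" by (simp add: e_def)
  have cont: "continuous_on UNIV \<phi>" "continuous_on UNIV \<psi>" using D by (auto simp: \<psi>_def)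
  have supp: "\<phi> x \<noteq> 0 \<Longrightarrow> x \<in> K" "\<psi> x \<noteq> 0 \<Longrightarrow> x \<in> K" for x
    using D(4)[of x e] closure_subset[of "{x. \<phi> x \<noteq> 0}"] by (auto simp: K_def \<psi>_def)
  have supp0: "\<phi> x = 0" "\<psi> x = 0" if "x \<notin> K" for x
    using supp[of x] that by auto
  obtain M where M: "M \<ge> 0" "\<And>x. \<bar>\<phi> x\<bar> \<le> M"
    using continuous_bounded_if_compact_support[OF cont(1) K(1) supp(1)] by blast
  obtain M' where M': "M' \<ge> 0" "\<And>x. \<bar>\<psi> x\<bar> \<le> M'"
    using continuous_bounded_if_compact_support[OF cont(2) K(1) supp(2)] by blast
  obtain B where B: "\<And>x. x \<in> K \<Longrightarrow> norm x \<le> B" using compact_imp_bounded[OF K(1)] by (auto simp: bounded_iff)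
  \<comment> \<open>The increments \<open>t n\<close> below are at most 1 and \<open>K\<close> lies
    within radius \<open>B\<close>, so all difference quotients vanish outside radius
    \<open>B + 1\<close>.\<close>
  have "bounded (u ` cball 0 (B + 1))"
    using contu by (intro compact_imp_bounded compact_continuous_image) (auto intro: continuous_on_subset)
  then obtain U where U: "\<And>x. norm x \<le> B + 1 \<Longrightarrow> norm (u x) \<le> U"
    unfolding bounded_iff by (metis imageI mem_cball_0)
  have contui: "continuous_on UNIV (\<lambda>x. u x $ i)"
    using contu by (intro continuous_intros)
  have \<phi>m[measurable]: "\<phi> \<in> borel_measurable borel" and \<psi>m[measurable]: "\<psi> \<in> borel_measurable borel"
    and uim[measurable]: "(\<lambda>x. u x $ i) \<in> borel_measurable borel"
    using cont contui by (simp_all add: borel_measurable_continuous_onI)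
  have Hm[measurable]: "(\<lambda>x. H x $ i $ j) \<in> borel_measurable borel"
    by (rule measurable_compose[OF H]) (intro borel_measurable_continuous_onI continuous_intros)
  define f where "f = (\<lambda>x. u x $ i * \<phi> x)"
  have fm[measurable]: "f \<in> borel_measurable borel" unfolding f_def using uim \<phi>m by (rule borel_measurable_times)
  have dline: "((\<lambda>\<tau>. x + \<tau> *\<^sub>R e) has_derivative (\<lambda>h. h *\<^sub>R e)) (at \<tau>)" for x \<tau>
    by (auto intro!: derivative_eq_intros)
  have \<phi>_diff: "\<bar>\<phi> (x + t *\<^sub>R e) - \<phi> x\<bar> \<le> M' * t" if "t > 0" for x t
  proof -
    have "\<exists>z>0. z < t \<and> \<phi> (x + t *\<^sub>R e) - \<phi> (x + 0 *\<^sub>R e) = (t - 0) * \<psi> (x + z *\<^sub>R e)"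
    proof (rule MVT2[OF that])
      fix \<tau> :: real
      note has_derivative_compose[OF dline[of x] D(2), of \<tau>]
      moreover have "frechet_derivative \<phi> (at (x + \<tau> *\<^sub>R e)) (h *\<^sub>R e) = \<psi> (x + \<tau> *\<^sub>R e) * h" for h
        using linear_scale[OF has_derivative_linear[OF D(2)]] by (simp add: \<psi>_def mult.commute)
      ultimately show "((\<lambda>\<tau>. \<phi> (x + \<tau> *\<^sub>R e)) has_field_derivative \<psi> (x + \<tau> *\<^sub>R e)) (at \<tau>)"
        by (simp add: has_field_derivative_def)
    qed
    then obtain z where "\<phi> (x + t *\<^sub>R e) - \<phi> x = t * \<psi> (x + z *\<^sub>R e)" by auto
    then show ?thesis using M'(2)[of "x + z *\<^sub>R e"] that by (simp add: abs_mult mult.commute)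
  qed
  define t where "t = (\<lambda>n. inverse (real (Suc n)))"
  have t: "t n > 0" "t n \<le> 1" for n by (simp_all add: t_def field_simps)
  have t_lim: "t \<longlonglongrightarrow> 0" unfolding t_def by (rule LIMSEQ_inverse_real_of_nat)
  define s where "s = (\<lambda>n x. (f (x + t n *\<^sub>R e) - f x) / t n)"
  \<comment> \<open>This is the limit of \<open>s n\<close> predicted by the product rule. The
    indicators match the integrals over \<open>D\<close> in the goal.\<close>
  define g where "g = (\<lambda>x. indicator D x * (u x $ i * \<psi> x) + indicator D x * (H x $ i $ j * \<phi> x))"
  have [measurable]: "D \<in> sets borel" using \<open>open D\<close> by simp
  have HC': "\<bar>H x $ i $ j\<bar> \<le> C" for x
    using component_le_norm_cart[of "H x $ i" j] Finite_Cartesian_Product.norm_nth_le[of "H x" i] HC[of x]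
    by linarith
  have C0: "C \<ge> 0" using HC'[of 0] by linarith
  have lim: "AE x in lborel. (\<lambda>n. s n x) \<longlonglongrightarrow> g x"
    using deriv
  proof eventually_elim
    case (elim x)
    have "((\<lambda>\<tau>. f (x + \<tau> *\<^sub>R e)) has_field_derivative g x) (at 0)"
    proof (cases "x \<in> D")
      case True
      with elim have du: "(u has_derivative (\<lambda>h. H x *v h)) (at x)" by simp
      have "(f has_derivative (\<lambda>h. u x $ i * frechet_derivative \<phi> (at x) h + (H x *v h) $ i * \<phi> x)) (at x)"
        unfolding f_def by (rule has_derivative_mult[OF bounded_linear.has_derivative[OF bounded_linear_vec_nth du] D(2)])
      then have "(f has_derivative (\<lambda>h. u x $ i * frechet_derivative \<phi> (at x) h + (H x *v h) $ i * \<phi> x))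
          (at (x + 0 *\<^sub>R e))" by simp
      note has_derivative_compose[OF dline[of x] this]
      moreover have "u x $ i * frechet_derivative \<phi> (at x) (h *\<^sub>R e) + (H x *v (h *\<^sub>R e)) $ i * \<phi> x
          = g x * h" for h
        using True linear_scale[OF has_derivative_linear[OF D(2)[of x]], of h e]
        by (simp add: g_def \<psi>_def e_def matrix_vector_mult_scaleR matrix_vector_mult_basis column_def
            algebra_simps)
      ultimately show ?thesis by (simp add: has_field_derivative_def)
    next
      case False
      then have "x \<in> - K" using K by auto
      define V where "V = (\<lambda>\<tau>::real. x + \<tau> *\<^sub>R e) -` (- K)"
      have "open V"
        unfolding V_def using compact_imp_closed[OF K(1)]
        by (intro open_vimage) (auto intro!: continuous_intros simp: open_closed)
      have z: "0 = f (x + \<tau> *\<^sub>R e)" if "\<tau> \<in> V" for \<tau>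
        using that supp(1)[of "x + \<tau> *\<^sub>R e"] by (auto simp: V_def f_def)
      have "((\<lambda>\<tau>. f (x + \<tau> *\<^sub>R e)) has_field_derivative 0) (at 0)"
        by (rule has_field_derivative_transform_within_open[OF DERIV_const \<open>open V\<close> _ z])
          (use \<open>x \<in> - K\<close> in \<open>auto simp: V_def\<close>)
      then show ?thesis using False by (simp add: g_def)
    qed
    then have "(\<lambda>h. (f (x + h *\<^sub>R e) - f x) / h) \<midarrow>0\<rightarrow> g x"
      by (simp add: DERIV_def)
    moreover have "filterlim t (at 0) sequentially"
      using t_lim t(1) by (auto simp: filterlim_at less_imp_neq[symmetric])
    ultimately show ?case unfolding s_def by (rule filterlim_compose)
  qed
  have bound: "norm (s n x) \<le> indicator (cball 0 (B + 1)) x * (L * M + U * M')" for n x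
  proof (cases "norm x \<le> B + 1")
    case True
    let ?y = "x + t n *\<^sub>R e"
    have "\<bar>u ?y $ i - u x $ i\<bar> \<le> norm (u ?y - u x)"
      using component_le_norm_cart[of "u ?y - u x" i] by simp
    also have "\<dots> \<le> L * t n"
      using lipschitz_onD[OF lip, of ?y x] e1 t(1)[of n] by (simp add: dist_norm)
    finally have 1: "\<bar>u ?y $ i - u x $ i\<bar> * \<bar>\<phi> ?y\<bar> \<le> (L * t n) * M"
      using M by (intro mult_mono) auto
    have 2: "\<bar>u x $ i\<bar> * \<bar>\<phi> ?y - \<phi> x\<bar> \<le> U * (M' * t n)"
      using U[OF True] component_le_norm_cart[of "u x" i] \<phi>_diff[OF t(1), of x n]
      by (intro mult_mono) auto
    \<comment> \<open>In this splitting each summand carries a factor \<open>t n\<close>: the first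
      by the Lipschitz bound of \<open>u\<close>, the second by the mean value bound of
      \<open>\<phi>\<close>. Only the value \<open>u x\<close> at the unshifted point has to be
      bounded.\<close>
    have "f ?y - f x = (u ?y $ i - u x $ i) * \<phi> ?y + u x $ i * (\<phi> ?y - \<phi> x)"
      by (simp add: f_def algebra_simps)
    then have "\<bar>f ?y - f x\<bar> \<le> \<bar>u ?y $ i - u x $ i\<bar> * \<bar>\<phi> ?y\<bar> + \<bar>u x $ i\<bar> * \<bar>\<phi> ?y - \<phi> x\<bar>"
      by (metis abs_mult abs_triangle_ineq)
    also have "\<dots> \<le> (L * M + U * M') * t n" using 1 2 by (simp add: algebra_simps)
    finally show ?thesis using t(1)[of n] True by (simp add: s_def abs_divide field_simps)
  next
    case False
    have "norm x - t n \<le> norm (x + t n *\<^sub>R e)"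
      using norm_diff_ineq[of x "t n *\<^sub>R e"] e1 t(1)[of n] by simp
    then have "x + t n *\<^sub>R e \<notin> K" "x \<notin> K" using B False t(2)[of n] by force+
    then have "\<phi> (x + t n *\<^sub>R e) = 0" "\<phi> x = 0" using supp(1) by blast+
    then have "s n x = 0" by (simp add: s_def f_def)
    then show ?thesis using False by simp
  qed
  have w_int: "integrable lborel (\<lambda>x::real^2. indicator (cball 0 (B + 1)) x * (L * M + U * M'))"
    by (rule integrable_lborel_bounded_support[where W = "\<bar>L * M + U * M'\<bar>" and K = "cball 0 (B + 1)"])
      (auto simp: indicator_def)
  have [measurable]: "s n \<in> borel_measurable borel" "g \<in> borel_measurable borel" for n
    unfolding s_def g_def by measurable
  have "(\<lambda>n. \<integral>x. s n x \<partial>lborel) \<longlonglongrightarrow> (\<integral>x. g x \<partial>lborel)"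
    by (rule integral_dominated_convergence[OF _ _ w_int lim]) (use bound in auto)
  moreover have "(\<integral>x. s n x \<partial>lborel) = 0" for n
  proof -
    have "\<bar>f x\<bar> \<le> \<bar>U\<bar> * M" for x
    proof (cases "x \<in> K")
      case True
      then have "\<bar>u x $ i\<bar> \<le> \<bar>U\<bar>" using U[of x] B[of x] component_le_norm_cart[of "u x" i] by linarith
      then show ?thesis using M by (auto simp: f_def abs_mult intro: mult_mono)
    qed (use M in \<open>simp add: f_def supp0\<close>)
    then have f_int: "integrable lborel f"
      using K(1) supp
      by (intro integrable_lborel_bounded_support[where K = K and W = "\<bar>U\<bar> * M"])
        (auto simp: compact_imp_bounded f_def)
    have "integrable lborel (\<lambda>x. f (t n *\<^sub>R e + x))"
      using f_int integrable_distr_eq[of "(+) (t n *\<^sub>R e)" lborel borel f]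
      by (simp add: lborel_distr_plus)
    then show ?thesis
      using f_int integral_lborel_translate[OF fm, of "t n *\<^sub>R e"]
      by (simp add: s_def add.commute)
  qed
  ultimately have int0: "(\<integral>x. g x \<partial>lborel) = 0" by (simp add: LIMSEQ_const_iff)
  have g1: "integrable lborel (\<lambda>x. indicator D x * (u x $ i * \<psi> x))"
  proof (rule integrable_lborel_bounded_support[where K = K and W = "\<bar>U\<bar> * M'"])
    show "norm (indicator D x * (u x $ i * \<psi> x)) \<le> \<bar>U\<bar> * M'" for x
    proof (cases "x \<in> K")
      case True
      then have "\<bar>u x $ i\<bar> \<le> \<bar>U\<bar>" using U[of x] B[of x] component_le_norm_cart[of "u x" i] by linarith
      then show ?thesis using M' by (auto simp: abs_mult indicator_def intro: mult_mono)
    qed (use M' in \<open>simp add: supp0\<close>)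
  qed (use K supp in \<open>auto simp: compact_imp_bounded\<close>)
  have g2: "integrable lborel (\<lambda>x. indicator D x * (H x $ i $ j * \<phi> x))"
  proof (rule integrable_lborel_bounded_support[where K = K and W = "C * M"])
    show "norm (indicator D x * (H x $ i $ j * \<phi> x)) \<le> C * M" for x
      using HC'[of x] M C0 by (auto simp: abs_mult indicator_def intro: mult_mono)
  qed (use K supp in \<open>auto simp: compact_imp_bounded\<close>)
  have "(LINT x:D|lebesgue. u x $ i * \<psi> x) = (\<integral>x. indicator D x * (u x $ i * \<psi> x) \<partial>lborel)"
    unfolding set_lebesgue_integral_def by (subst integral_completion) auto
  moreover have "(LINT x:D|lebesgue. H x $ i $ j * \<phi> x) = (\<integral>x. indicator D x * (H x $ i $ j * \<phi> x) \<partial>lborel)"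
    unfolding set_lebesgue_integral_def by (subst integral_completion) auto
  ultimately show "(LINT x:D|lebesgue. u x $ i * frechet_derivative \<phi> (at x) (axis j 1)) =
        - (LINT x:D|lebesgue. H x $ i $ j * \<phi> x)"
    using int0 Bochner_Integration.integral_add[OF g1 g2] by (simp add: g_def \<psi>_def e_def)
qed

section \<open>Piecewise affine maps\<close>

text \<open>Along the segment from \<open>x\<close> to \<open>y\<close> the closed sets cut
  \<open>{0..1}\<close> into finitely many closed sets, on each of which the same Lipschitz constant
  holds, and such bounds glue on an interval. One of the sets can thus be the complement of an open
  triangle.\<close>

lemma lipschitz_on_piecewise_affine:
  fixes u :: "real^'n \<Rightarrow> real^'m"
  assumes "finite I" and closed: "\<And>i. i \<in> I \<Longrightarrow> closed (U i)"
    and cover: "(\<Union>i\<in>I. U i) = UNIV"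
    and u: "\<And>i x. i \<in> I \<Longrightarrow> x \<in> U i \<Longrightarrow> u x = A i *v x + b i"
  obtains L where "L-lipschitz_on UNIV u"
proof -
  have "\<exists>K. \<forall>i\<in>I. \<forall>x. norm (A i *v x) \<le> K * norm x"
    using \<open>finite I\<close>
  proof (induction I)
    case (insert i I)
    obtain K1 where K1: "\<And>j x. j \<in> I \<Longrightarrow> norm (A j *v x) \<le> K1 * norm x"
      using insert.IH by blast
    obtain K2 where K2: "\<And>x. norm (A i *v x) \<le> norm x * K2"
      using bounded_linear.bounded[OF matrix_vector_mul_bounded_linear] by blast
    have "norm (A j *v x) \<le> max K1 K2 * norm x" if "j \<in> insert i I" for j x
      using that K1[of j x] K2[of x] mult_right_mono[of K1 "max K1 K2" "norm x"]
        mult_right_mono[of K2 "max K1 K2" "norm x"]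
      by (auto simp: mult.commute intro: order_trans)
    then show ?case by blast
  qed auto
  then obtain K' where K': "\<And>i x. i \<in> I \<Longrightarrow> norm (A i *v x) \<le> K' * norm x" by blast
  define K where "K = max K' 0"
  have K: "norm (A i *v x) \<le> K * norm x" if "i \<in> I" for i x
    using K'[OF that, of x] mult_right_mono[of K' K "norm x"] by (simp add: K_def)
  have K0: "K \<ge> 0" by (simp add: K_def)
  have "K-lipschitz_on UNIV u"
  proof (rule lipschitz_onI)
    fix x y :: "real^'n"
    define g where "g = (\<lambda>\<tau>::real. x + \<tau> *\<^sub>R (y - x))"
    have "(K * norm (y - x))-lipschitz_on {0..1} (u \<circ> g)"
    proof (rule lipschitz_on_closed_Union[where I = I and U = "\<lambda>i. g -` U i"])
      fix i assume i: "i \<in> I"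
      show "closed (g -` U i)"
        using closed[OF i] by (rule closed_vimage) (auto simp: g_def intro!: continuous_intros)
      show "(K * norm (y - x))-lipschitz_on (g -` U i) (u \<circ> g)"
      proof (rule lipschitz_onI)
        fix \<sigma> \<tau> assume \<sigma>\<tau>: "\<sigma> \<in> g -` U i" "\<tau> \<in> g -` U i"
        have "dist ((u \<circ> g) \<sigma>) ((u \<circ> g) \<tau>) = norm (A i *v (g \<sigma> - g \<tau>))"
          using \<sigma>\<tau> u[OF i] by (simp add: dist_norm matrix_vector_mult_diff_distrib)
        also have "\<dots> \<le> K * norm (g \<sigma> - g \<tau>)" by (rule K[OF i])
        also have "g \<sigma> - g \<tau> = (\<sigma> - \<tau>) *\<^sub>R (y - x)" by (simp add: g_def algebra_simps)
        finally show "dist ((u \<circ> g) \<sigma>) ((u \<circ> g) \<tau>) \<le> K * norm (y - x) * dist \<sigma> \<tau>"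
          by (simp add: dist_real_def mult_ac)
      qed (simp add: K0)
    next
      have "g \<tau> \<in> (\<Union>i\<in>I. U i)" for \<tau> unfolding cover by simp
      then show "{0..1} \<subseteq> (\<Union>i\<in>I. g -` U i)" by auto
    qed (use \<open>finite I\<close> K0 in auto)
    from lipschitz_onD[OF this, of 0 1]
    show "dist (u x) (u y) \<le> K * dist x y"
      by (simp add: g_def dist_norm norm_minus_commute)
  qed (rule K0)
  then show ?thesis by (rule that)
qed


section \<open>Slip directions and rotations\<close>

lemma matrix_vector_mult_22: "(vector [vector [a, b], vector [c, d]] :: mat2) *v x
    = vector [a * x$1 + b * x$2, c * x$1 + d * x$2]"
  by (simp add: vec_eq_iff forall_2 matrix_vector_mult_def sum_2)

text \<open>The difference of the squared norms of \<open>A *v v\<close> and \<open>v\<close> is a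
  binary quadratic form. For determinant 1 its discriminant \<open>q^2 - p * r\<close> is a sum of
  two squares, so the form is not definite and has a nontrivial zero, which is then
  normalised.\<close>

lemma isotropic_direction:
  fixes A :: mat2
  assumes "det A = 1"
  obtains v where "norm v = 1" "norm (A *v v) = 1"
proof -
  define p where "p = (A$1$1)^2 + (A$2$1)^2 - 1"
  define q where "q = A$1$1 * A$1$2 + A$2$1 * A$2$2"
  define r where "r = (A$1$2)^2 + (A$2$2)^2 - 1"
  have form: "(norm (A *v v))^2 - (norm v)^2 = p * (v$1)^2 + 2 * q * v$1 * v$2 + r * (v$2)^2" for v
    by (simp add: power2_norm_eq_inner inner_vec_def sum_2 matrix_vector_mult_def p_def q_def r_def)
      (simp add: power2_eq_square algebra_simps)
  have "q^2 - p * r = (A$1$1 - A$2$2)^2 + (A$1$2 + A$2$1)^2 + 2 * (det A - 1) - ((det A)^2 - 1)"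
    by (simp add: p_def q_def r_def det_2 power2_eq_square algebra_simps)
  then have disc: "q^2 - p * r \<ge> 0" using assms by simp
  have "\<exists>w :: real^2. w \<noteq> 0 \<and> p * (w$1)^2 + 2 * q * w$1 * w$2 + r * (w$2)^2 = 0"
  proof (cases "p = 0")
    case True
    then show ?thesis by (intro exI[of _ "vector [1, 0] :: real^2"]) (simp add: vec_eq_iff forall_2)
  next
    case False
    \<comment> \<open>\<open>(\<delta> - q) / p\<close> is a root of the quadratic with coefficients
      \<open>p\<close>, \<open>2 * q\<close>, \<open>r\<close>; the witness is this root in
      homogeneous form, scaled by \<open>p\<close>.\<close>
    define \<delta> where "\<delta> = sqrt (q^2 - p * r)"
    have \<delta>: "\<delta>^2 = q^2 - p * r" using disc by (simp add: \<delta>_def)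
    have "p * (\<delta> - q)^2 + 2 * q * (\<delta> - q) * p + r * p^2 = p * (\<delta>^2 - (q^2 - p * r))"
      by (simp add: power2_eq_square algebra_simps)
    then show ?thesis using False \<delta>
      by (intro exI[of _ "vector [\<delta> - q, p] :: real^2"]) (simp add: vec_eq_iff forall_2)
  qed
  then obtain w where w: "w \<noteq> 0" "norm (A *v w) = norm w"
    using form by (metis diff_eq_diff_eq diff_self eq_iff_diff_eq_0 norm_ge_zero power2_eq_iff_nonneg)
  show ?thesis
  proof (rule that[of "w /\<^sub>R norm w"])
    show "norm (w /\<^sub>R norm w) = 1" using w(1) by simp
    show "norm (A *v (w /\<^sub>R norm w)) = 1"
      using w by (simp add: matrix_vector_mult_scaleR)
  qed
qed

text \<open>The conclusion says that the resultant of the two forms vanishes. Eliminating in turn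
  the square of \<open>x\<close>, the square of \<open>y\<close> and the mixed term leaves three
  relations between the 2 by 2 minors of the coefficients, which combine to it.\<close>

lemma binary_forms_common_zero:
  fixes x y :: real
  assumes "x \<noteq> 0 \<or> y \<noteq> 0"
    and 1: "p * x^2 + 2 * q * x * y + r * y^2 = 0"
    and 2: "p' * x^2 + 2 * q' * x * y + r' * y^2 = 0"
  shows "(p * r' - p' * r)^2 = 4 * (p * q' - p' * q) * (q * r' - q' * r)"
proof -
  define \<alpha> \<beta> \<gamma> where abc: "\<alpha> = p * r' - p' * r" "\<beta> = p * q' - p' * q" "\<gamma> = q * r' - q' * r"
  have y: "y * (2 * \<beta> * x + \<alpha> * y) = 0"
  proof -
    have "y * (2 * \<beta> * x + \<alpha> * y) = p * (p' * x^2 + 2 * q' * x * y + r' * y^2)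
        - p' * (p * x^2 + 2 * q * x * y + r * y^2)"
      by (simp add: abc power2_eq_square algebra_simps)
    then show ?thesis unfolding 1 2 by simp
  qed
  have x: "x * (\<alpha> * x + 2 * \<gamma> * y) = 0"
  proof -
    have "x * (\<alpha> * x + 2 * \<gamma> * y) = r' * (p * x^2 + 2 * q * x * y + r * y^2)
        - r * (p' * x^2 + 2 * q' * x * y + r' * y^2)"
      by (simp add: abc power2_eq_square algebra_simps)
    then show ?thesis unfolding 1 2 by simp
  qed
  have xy: "\<beta> * x^2 = \<gamma> * y^2"
  proof -
    have "\<beta> * x^2 - \<gamma> * y^2 = q' * (p * x^2 + 2 * q * x * y + r * y^2)
        - q * (p' * x^2 + 2 * q' * x * y + r' * y^2)"
      by (simp add: abc power2_eq_square algebra_simps)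
    then show ?thesis unfolding 1 2 by simp
  qed
  have "\<alpha>^2 = 4 * \<beta> * \<gamma>"
  proof (cases "x = 0 \<or> y = 0")
    case True
    then show ?thesis using assms(1) x y xy by auto
  next
    case False
    then have "\<alpha> * x = - (2 * \<gamma> * y)" "\<alpha> * y = - (2 * \<beta> * x)" using x y by auto
    then have "(\<alpha> * x) * (\<alpha> * y) = (2 * \<gamma> * y) * (2 * \<beta> * x)" by simp
    then have "(\<alpha>^2 - 4 * \<beta> * \<gamma>) * (x * y) = 0" by (simp add: power2_eq_square algebra_simps)
    then show ?thesis using False by simp
  qed
  then show ?thesis by (simp add: abc)
qed

definition rot :: "real^2 \<Rightarrow> mat2" where
  "rot v = vector [vector [v$1, - v$2], vector [v$2, v$1]]"

lemma rotation_matrix_rot: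
  assumes "norm v = 1"
  shows "rotation_matrix (rot v)"
proof -
  have "v$1 * v$1 + v$2 * v$2 = 1"
    using assms by (simp add: norm_eq_1 inner_vec_def sum_2)
  then show ?thesis
    by (simp add: rotation_matrix_def orthogonal_matrix rot_def det_2 vec_eq_iff forall_2
        matrix_matrix_mult_def transpose_def mat_def sum_2 algebra_simps)
qed

lemma rot_axis: "rot v *v axis 1 1 = v"
  by (simp add: rot_def matrix_vector_mult_22 vec_eq_iff forall_2 axis_def)

lemma mem_rotated_iff:
  assumes "rotation_matrix R"
  shows "F \<in> rotated S R \<longleftrightarrow> F ** R \<in> S"
proof -
  have "R ** transpose R = mat 1" "transpose R ** R = mat 1"
    using assms by (auto simp: rotation_matrix_def orthogonal_matrix_def)
  then show ?thesis
    unfolding rotated_def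
    by (auto simp: matrix_mul_assoc[symmetric]) (metis matrix_mul_assoc matrix_mul_rid)
qed

lemma mem_rotated_M_iff:
  assumes "rotation_matrix R"
  shows "F \<in> rotated M_set R \<longleftrightarrow> det F = 1 \<and> norm (F *v (R *v axis 1 1)) = 1"
  using assms by (simp add: mem_rotated_iff M_set_def det_mul rotation_matrix_def matrix_vector_mul_assoc)

lemma mem_rotated_N_iff:
  assumes "rotation_matrix R"
  shows "F \<in> rotated N_set R \<longleftrightarrow> det F = 1 \<and> norm (F *v (R *v axis 1 1)) \<le> 1"
  using assms by (simp add: mem_rotated_iff N_set_def det_mul rotation_matrix_def matrix_vector_mul_assoc)

text \<open>Area preservation forces equality in Hadamard's inequality for the two columns.\<close>
lemma rotation_matrix_if_columns_le_1:
  fixes F :: mat2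
  assumes "det F = 1" "norm (F *v axis 1 1) \<le> 1" "norm (F *v axis 2 1) \<le> 1"
  shows "rotation_matrix F"
proof -
  have col: "(norm (F *v axis i 1))^2 = (F$1$i)^2 + (F$2$i)^2" for i
    unfolding power2_norm_eq_inner
    by (simp add: inner_vec_def sum_2 matrix_vector_mult_basis column_def power2_eq_square)
  have 1: "(F$1$1)^2 + (F$2$1)^2 \<le> 1" and 2: "(F$1$2)^2 + (F$2$2)^2 \<le> 1"
    using power_mono[OF assms(2), of 2] power_mono[OF assms(3), of 2] by (simp_all add: col)
  have d: "F$1$1 * F$2$2 - F$1$2 * F$2$1 = 1" using assms(1) by (simp add: det_2)
  \<comment> \<open>The left side is the sum of the squared entries minus twice the determinant,
    hence at most 1 + 1 - 2.\<close>
  have "(F$1$1 - F$2$2)^2 + (F$1$2 + F$2$1)^2 \<le> 0"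
    using 1 2 d by (simp add: power2_eq_square algebra_simps)
  then have "F$2$2 = F$1$1" "F$1$2 = - F$2$1"
    by (simp_all add: sum_power2_le_zero_iff)
  then have "F = rot (F *v axis 1 1)" "(F$1$1)^2 + (F$2$1)^2 = 1"
    using d by (simp_all add: vec_eq_iff forall_2 rot_def matrix_vector_mult_basis column_def
        power2_eq_square)
  moreover have "norm (F *v axis 1 1) = 1"
    using \<open>(F$1$1)^2 + (F$2$1)^2 = 1\<close> col[of 1] norm_ge_zero
    by (metis one_power2 power2_eq_iff_nonneg zero_le_one)
  ultimately show ?thesis using rotation_matrix_rot by metis
qed

section \<open>Criteria for attainability\<close>

text \<open>A bounded Borel function \<open>H\<close> that is the classical derivative almost
  everywhere in \<open>D\<close> is a weak gradient. It serves both for membership in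
  \<open>W1_infinity\<close> and for the differential inclusion; continuity up to the boundary comes
  from the Lipschitz bound on the whole plane.\<close>

lemma attainable_MI:
  fixes u :: "real^2 \<Rightarrow> real^2" and H :: "real^2 \<Rightarrow> mat2"
  assumes "open D" "bounded D" and lip: "L-lipschitz_on UNIV u"
    and H: "H \<in> borel_measurable borel" and HC: "\<And>x. norm (H x) \<le> C"
    and deriv: "AE x in lborel. x \<in> D \<longrightarrow>
      (u has_derivative (\<lambda>h. H x *v h)) (at x) \<and> H x \<in> rotated M_set (R x)"
    and bdry: "\<And>x. x \<in> frontier D \<Longrightarrow> u x = F *v x"
  shows "F \<in> attainable_M D R"
proof -
  have weak: "has_weak_gradient D u H"
    using deriv by (intro has_weak_gradient_lipschitz[OF \<open>open D\<close> lip H HC]) auto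
  have contu: "continuous_on UNIV u" using lip by (rule lipschitz_on_continuous_on)
  have meas: "f \<in> borel_measurable (lebesgue_on D)" if "f \<in> borel_measurable borel"
    for f :: "real^2 \<Rightarrow> 'b::euclidean_space"
    by (intro measurable_restrict_space1 measurable_completion) (use that in simp)
  have "bounded (u ` closure D)"
    using contu \<open>bounded D\<close>
    by (intro compact_imp_bounded compact_continuous_image) (auto intro: continuous_on_subset)
  then obtain W where W: "\<And>x. x \<in> D \<Longrightarrow> norm (u x) \<le> W"
    unfolding bounded_iff using closure_subset by blast
  have D: "D \<in> sets lebesgue" using \<open>open D\<close> by auto
  have "u \<in> L_infinity D"
    unfolding L_infinity_def using W meas[OF borel_measurable_continuous_onI[OF contu]] D
    by (auto simp: AE_restrict_space_iff intro!: exI[of _ W])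
  moreover have "H \<in> L_infinity D"
    unfolding L_infinity_def using HC meas[OF H] by auto
  ultimately have "u \<in> W1_infinity D" unfolding W1_infinity_def using weak by auto
  moreover have "AE x in lebesgue_on D. H x \<in> rotated M_set (R x)"
    using D AE_completion[OF deriv] by (auto simp: AE_restrict_space_iff)
  ultimately show ?thesis
    unfolding attainable_M_def using weak bdry continuous_on_subset[OF contu] by blast
qed

lemma rotation_matrix_norm:
  fixes R :: "real^'n^'n"
  assumes "rotation_matrix R"
  shows "norm (R *v x) = norm x"
  using assms orthogonal_transformation_matrix[of "(*v) R"]
  by (auto simp: rotation_matrix_def orthogonal_transformation)

text \<open>A rotation preserves the length of every vector, so the linear map itself satisfies the
  inclusion whatever the slip direction of a grain is.\<close>

lemma rotation_attainable_M:
  assumes "open D" "bounded D" and F: "rotation_matrix F" and R: "\<And>x. rotation_matrix (R x)"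
  shows "F \<in> attainable_M D R"
proof -
  have "F \<in> rotated M_set (R x)" for x
    using F R[of x] by (simp add: mem_rotated_M_iff rotation_matrix_norm) (simp add: rotation_matrix_def)
  moreover have "((*v) F has_derivative (*v) F) (at x)" for x :: "real^2"
    by (rule bounded_linear_imp_has_derivative) simp
  moreover have "1-lipschitz_on UNIV ((*v) F)"
    by (rule lipschitz_onI)
      (simp_all add: dist_norm rotation_matrix_norm[OF F] matrix_vector_mult_diff_distrib[symmetric])
  ultimately show ?thesis
    using assms(1,2) by (intro attainable_MI[where u = "(*v) F" and H = "\<lambda>_. F"]) auto
qed


section \<open>Open convex polygons\<close>

definition affine_form :: "real \<times> real \<times> real \<Rightarrow> real^2 \<Rightarrow> real" where
  "affine_form h x = fst h * x$1 + fst (snd h) * x$2 + snd (snd h)"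

text \<open>With polygons given by lists of linear inequalities, inclusion, disjointness and
  covering become linear arithmetic.\<close>

definition open_polygon :: "(real \<times> real \<times> real) list \<Rightarrow> (real^2) set" where
  "open_polygon hs = {x. \<forall>h\<in>set hs. 0 < affine_form h x}"

definition closed_polygon :: "(real \<times> real \<times> real) list \<Rightarrow> (real^2) set" where
  "closed_polygon hs = {x. \<forall>h\<in>set hs. 0 \<le> affine_form h x}"

lemma continuous_on_affine_form: "continuous_on S (affine_form h)"
  unfolding affine_form_def by (intro continuous_intros)

lemma affine_form_convex_combination:
  "affine_form h ((1 - t) *\<^sub>R x + t *\<^sub>R y) = (1 - t) * affine_form h x + t * affine_form h y"
  by (simp add: affine_form_def algebra_simps)

lemma open_open_polygon: "open (open_polygon hs)"
proof -
  have "open_polygon hs = (\<Inter>h\<in>set hs. {x. 0 < affine_form h x})" by (auto simp: open_polygon_def)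
  then show ?thesis
    by (auto intro!: open_INT open_Collect_less continuous_on_affine_form continuous_intros)
qed

lemma closed_closed_polygon: "closed (closed_polygon hs)"
proof -
  have "closed_polygon hs = (\<Inter>h\<in>set hs. {x. 0 \<le> affine_form h x})" by (auto simp: closed_polygon_def)
  then show ?thesis
    by (auto intro!: closed_INT closed_Collect_le continuous_on_affine_form continuous_intros)
qed

lemma open_polygon_segment:
  assumes "x \<in> closed_polygon hs" "y \<in> open_polygon hs" "0 < t" "t \<le> 1"
  shows "(1 - t) *\<^sub>R x + t *\<^sub>R y \<in> open_polygon hs"
  using assms by (auto simp: open_polygon_def closed_polygon_def affine_form_convex_combination
      intro!: add_nonneg_pos)

lemma open_polygon_subset: "open_polygon hs \<subseteq> closed_polygon hs"
  by (force simp: open_polygon_def closed_polygon_def)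

lemma convex_open_polygon: "convex (open_polygon hs)"
  unfolding convex_alt
proof (intro ballI allI impI)
  fix x y t assume "x \<in> open_polygon hs" "y \<in> open_polygon hs" "0 \<le> t \<and> t \<le> (1::real)"
  then show "(1 - t) *\<^sub>R x + t *\<^sub>R y \<in> open_polygon hs"
    using open_polygon_segment[of x hs y t] open_polygon_subset[of hs] by (cases "t = 0") auto
qed

text \<open>A point \<open>y\<close> satisfying all inequalities strictly is what makes this work:
  moving a point of the closed polygon slightly towards \<open>y\<close> makes its inequalities
  strict too.\<close>

lemma closure_open_polygon:
  assumes "open_polygon hs \<noteq> {}"
  shows "closure (open_polygon hs) = closed_polygon hs"
proof
  show "closure (open_polygon hs) \<subseteq> closed_polygon hs"
    by (rule closure_minimal[OF open_polygon_subset closed_closed_polygon])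
  obtain y where y: "y \<in> open_polygon hs" using assms by blast
  show "closed_polygon hs \<subseteq> closure (open_polygon hs)"
  proof
    fix x assume x: "x \<in> closed_polygon hs"
    define t where "t = (\<lambda>n. inverse (real (Suc n)))"
    have t: "0 < t n" "t n \<le> 1" for n by (simp_all add: t_def field_simps)
    have "t \<longlonglongrightarrow> 0" unfolding t_def by (rule LIMSEQ_inverse_real_of_nat)
    then have "(\<lambda>n. (1 - t n) *\<^sub>R x + t n *\<^sub>R y) \<longlonglongrightarrow> (1 - 0) *\<^sub>R x + 0 *\<^sub>R y"
      by (intro tendsto_intros)
    moreover have "(1 - t n) *\<^sub>R x + t n *\<^sub>R y \<in> open_polygon hs" for n
      by (rule open_polygon_segment[OF x y t])
    ultimately show "x \<in> closure (open_polygon hs)"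
      unfolding closure_sequential by (auto intro!: exI[of _ "\<lambda>n. (1 - t n) *\<^sub>R x + t n *\<^sub>R y"])
  qed
qed


section \<open>The seven-grain triangle\<close>

text \<open>Index \<open>0\<close> belongs to the whole triangle, with vertices \<open>(0, 0), (6, 0), (0, 6)\<close>, and to the shear;
  the indices \<open>1, \<dots>, 7\<close> belong to the grains. The inner points \<open>B\<^sub>i\<close> are \<open>(3, 1), (2, 3), (1, 2)\<close>; the
  twist moves them to \<open>(2, 1), (3, 2), (1, 3)\<close>.\<close>
definition sides :: "nat \<Rightarrow> (real \<times> real \<times> real) list" where
  "sides k =
    [[(1, 0, 0), (0, 1, 0), (-1, -1, 6)],
     [(0, 1, 0), (-1, -3, 6), (1, -3, 0)],
     [(-1, -1, 6), (3, 2, -12), (3, 4, -18)],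
     [(1, 0, 0), (-2, 1, 0), (-4, -1, 6)],
     [(-3, -4, 18), (2, 1, -7), (1, 3, -6)],
     [(4, 1, -6), (-1, 1, -1), (-3, -2, 12)],
     [(-1, 3, 0), (-1, -2, 5), (2, -1, 0)],
     [(-2, -1, 7), (1, -1, 1), (1, 2, -5)]] ! k"

text \<open>These are the linear parts of the shear after the twist, which sends the inner points to
  (3, 1), (5, 2), (4, 3). Grains 1 to 3 rest on a side of the triangle, grains 4 to 6 touch it in
  one vertex, and grain 7 is the inner triangle. Grain 1 carries the identity and grain 7 a quarter
  turn.\<close>

definition slope :: "nat \<Rightarrow> mat2" where
  "slope k =
    [vector [vector [1, 1], vector [0, 1]],
     vector [vector [1, 0], vector [0, 1]],
     vector [vector [1, 1], vector [1, 2]],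
     vector [vector [2, 1], vector [1, 1]],
     vector [vector [8/5, 9/5], vector [-1/5, 2/5]],
     vector [vector [2/5, 3/5], vector [-7/5, 2/5]],
     vector [vector [2/5, 9/5], vector [-1/5, 8/5]],
     vector [vector [0, 1], vector [-1, 0]]] ! k"

definition offset :: "nat \<Rightarrow> real^2" where
  "offset k =
    [vector [0, 0], vector [0, 0], vector [0, -6], vector [0, 0], vector [-18/5, 6/5],
     vector [12/5, 18/5], vector [0, 0], vector [2, 4]] ! k"

abbreviation triangle :: "(real^2) set" where
  "triangle \<equiv> open_polygon (sides 0)"

abbreviation grain :: "nat \<Rightarrow> (real^2) set" where
  "grain k \<equiv> open_polygon (sides k)"

abbreviation closed_grain :: "nat \<Rightarrow> (real^2) set" where
  "closed_grain k \<equiv> closed_polygon (sides k)"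

text \<open>The closed complement of the triangle is treated as one more piece, moved by the shear.
  The deformation is then defined on the whole plane and has the boundary values built in.\<close>

definition piece :: "nat \<Rightarrow> (real^2) set" where
  "piece k = (if k = 0 then - triangle else closed_grain k)"

text \<open>Closed pieces overlap along edges; \<open>LEAST\<close> is a tie-break whose outcome is
  immaterial by \<open>piece_consistent\<close>.\<close>

definition deformation :: "real^2 \<Rightarrow> real^2" where
  "deformation x = (let k = (LEAST k. x \<in> piece k) in slope k *v x + offset k)"

section \<open>Incidences of the seven grains\<close>

lemma ball_1_7: "(\<forall>k\<in>{1..7::nat}. P k) \<longleftrightarrow> P 1 \<and> P 2 \<and> P 3 \<and> P 4 \<and> P 5 \<and> P 6 \<and> P 7"
proof -
  have "{1..7::nat} = {1, 2, 3, 4, 5, 6, 7}" by auto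
  then show ?thesis by simp
qed

lemma ball_0_7: "(\<forall>k\<in>{0..7::nat}. P k) \<longleftrightarrow> P 0 \<and> (\<forall>k\<in>{1..7}. P k)"
proof -
  have "{0..7::nat} = insert 0 {1..7}" by auto
  then show ?thesis by simp
qed

lemmas polygon_simps = open_polygon_def closed_polygon_def affine_form_def sides_def

text \<open>Missing a closed grain means violating one of its three inequalities. No choice of one
  violated inequality per grain is compatible with those of the triangle.\<close>

lemma triangle_subset_pieces:
  "x \<in> triangle \<Longrightarrow> \<exists>k\<in>{1..7}. x \<in> closed_grain k"
proof (rule ccontr)
  assume x: "x \<in> triangle" and "\<not> (\<exists>k\<in>{1..7}. x \<in> closed_grain k)"
  then have "\<forall>k\<in>{1..7}. x \<notin> closed_grain k" by blast
  with x show False unfolding ball_1_7 by (simp add: polygon_simps) (smt (verit))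
qed

lemma grain_subset: "\<forall>k\<in>{1..7}. grain k \<subseteq> triangle"
  unfolding ball_1_7 by (auto simp: polygon_simps)

lemma closed_grain_subset: "\<forall>k\<in>{1..7}. closed_grain k \<subseteq> closed_polygon (sides 0)"
  unfolding ball_1_7 by (auto simp: polygon_simps)

lemma grain_nonempty: "\<forall>k\<in>{0..7}. grain k \<noteq> {}"
proof -
  have "vector [1, 1] \<in> grain 0" "vector [3, 1/3] \<in> grain 1" "vector [8/3, 3] \<in> grain 2"
    "vector [1/3, 8/3] \<in> grain 3" "vector [11/3, 4/3] \<in> grain 4" "vector [1, 11/3] \<in> grain 5"
    "vector [4/3, 1] \<in> grain 6" "vector [2, 2] \<in> grain 7"
    by (simp_all add: polygon_simps)
  then show ?thesis unfolding ball_0_7 ball_1_7 by blast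
qed

lemma grain_disjoint: "\<forall>k\<in>{1..7}. \<forall>l\<in>{1..7}. k < l \<longrightarrow> grain k \<inter> grain l = {}"
  unfolding ball_1_7 by (auto simp: polygon_simps)

text \<open>Two pieces meet at most in a common edge or vertex, or, for piece 0, in part of the
  boundary of the triangle. There both affine maps interpolate the same images of vertices.\<close>

lemma piece_consistent:
  "\<forall>k\<in>{0..7}. \<forall>l\<in>{0..7}. k < l \<longrightarrow>
    (\<forall>x\<in>piece k \<inter> piece l. slope k *v x + offset k = slope l *v x + offset l)"
  unfolding ball_0_7 ball_1_7
  by (auto simp: piece_def polygon_simps slope_def offset_def matrix_vector_mult_22 vec_eq_iff forall_2)

lemma bounded_triangle: "bounded triangle"
proof (rule boundedI)
  fix x assume "x \<in> triangle"
  then have "0 < x$1" "0 < x$2" "x$1 + x$2 < 6" by (simp_all add: polygon_simps)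
  then show "norm x \<le> 6" using norm_le_l1_cart[of x] by (simp add: sum_2)
qed


text \<open>Lets symmetric relations between grains be checked for the 21 pairs with
  \<open>k < l\<close> only.\<close>

lemma ball_less_imp_ball_neq:
  fixes A :: "nat set"
  assumes "\<forall>k\<in>A. \<forall>l\<in>A. k < l \<longrightarrow> P k l" "\<And>k l. P k l \<Longrightarrow> P l k" "k \<in> A" "l \<in> A" "k \<noteq> l"
  shows "P k l"
  using assms by (metis linorder_neqE_nat)

lemma grain_unique:
  assumes "k \<in> {1..7}" "l \<in> {1..7}" "x \<in> grain k" "x \<in> grain l"
  shows "k = l"
  using ball_less_imp_ball_neq[OF grain_disjoint, of k l] assms by blast

lemma closure_grain: "k \<in> {0..7} \<Longrightarrow> closure (grain k) = closed_grain k"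
  using grain_nonempty by (intro closure_open_polygon) blast

lemma Union_closed_grain: "(\<Union>k\<in>{1..7}. closed_grain k) = closure triangle"
proof
  show "(\<Union>k\<in>{1..7}. closed_grain k) \<subseteq> closure triangle"
    using closed_grain_subset closure_grain[of 0] by auto
  show "closure triangle \<subseteq> (\<Union>k\<in>{1..7}. closed_grain k)"
    by (rule closure_minimal) (use triangle_subset_pieces closed_closed_polygon in \<open>auto intro!: closed_UN\<close>)
qed

text \<open>A point of the triangle outside all open grains lies in a closed one, hence on the
  frontier of a convex set, which is a null set.\<close>

lemma negligible_triangle_minus_grains: "negligible (triangle - (\<Union>k\<in>{1..7}. grain k))"
proof (rule negligible_subset)
  show "negligible (\<Union>k\<in>{1..7}. frontier (grain k))"
    by (rule negligible_Union) (auto intro: negligible_convex_frontier convex_open_polygon)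
  show "triangle - (\<Union>k\<in>{1..7}. grain k) \<subseteq> (\<Union>k\<in>{1..7}. frontier (grain k))"
    using triangle_subset_pieces
    by (fastforce simp: frontier_def closure_grain interior_open open_open_polygon)
qed

lemma AE_grain: "AE x in lborel. x \<in> triangle \<longrightarrow> (\<exists>k\<in>{1..7}. x \<in> grain k)"
proof -
  have "AE x in lebesgue. x \<notin> triangle - (\<Union>k\<in>{1..7}. grain k)"
    using negligible_triangle_minus_grains unfolding negligible_iff_null_sets by (rule AE_not_in)
  then show ?thesis unfolding AE_completion_iff by eventually_elim blast
qed

lemma bounded_lipschitz_domain_grain: "k \<in> {0..7} \<Longrightarrow> bounded_lipschitz_domain (grain k)"
proof (rule bounded_lipschitz_domain_convex[OF open_open_polygon convex_open_polygon])
  assume k: "k \<in> {0..7}"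
  then have "grain k \<subseteq> triangle" using grain_subset by (cases "k = 0") auto
  then show "bounded (grain k)" using bounded_triangle bounded_subset by blast
  show "grain k \<noteq> {}" using k grain_nonempty by blast
qed

lemma closed_piece: "closed (piece k)"
  by (simp add: piece_def open_open_polygon closed_closed_polygon closed_Compl)

lemma Union_piece: "(\<Union>k\<in>{0..7}. piece k) = UNIV"
proof -
  have "x \<in> (\<Union>k\<in>{0..7}. piece k)" for x
  proof (cases "x \<in> triangle")
    case True
    then obtain k where "k \<in> {1..7}" "x \<in> closed_grain k" using triangle_subset_pieces by blast
    then show ?thesis by (intro UN_I[of k]) (auto simp: piece_def)
  qed (auto simp: piece_def intro: UN_I[of 0])
  then show ?thesis by blast
qed

lemma deformation_eq:
  assumes k: "k \<in> {0..7}" and x: "x \<in> piece k"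
  shows "deformation x = slope k *v x + offset k"
proof -
  define l where "l = (LEAST k. x \<in> piece k)"
  have l: "x \<in> piece l" "l \<le> k" unfolding l_def using x by (auto intro: LeastI Least_le)
  then have "slope l *v x + offset l = slope k *v x + offset k"
    using piece_consistent k x by (cases "l = k") auto
  then show ?thesis by (simp add: deformation_def l_def)
qed

lemma deformation_has_derivative:
  assumes "k \<in> {1..7}" "x \<in> grain k"
  shows "(deformation has_derivative (*v) (slope k)) (at x)"
proof (rule has_derivative_transform_within_open)
  show "((\<lambda>x. slope k *v x + offset k) has_derivative (*v) (slope k)) (at x)"
    by (auto intro!: derivative_eq_intros bounded_linear_imp_has_derivative)
  show "slope k *v y + offset k = deformation y" if "y \<in> grain k" for y
    using deformation_eq[of k y] that assms(1) open_polygon_subset[of "sides k"]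
    by (auto simp: piece_def)
qed (use assms open_open_polygon in auto)

section \<open>Slip directions of the seven grains\<close>

lemma det_slope: "\<forall>k\<in>{1..7}. det (slope k) = 1"
  unfolding ball_1_7 by (simp add: slope_def det_2)

text \<open>Coefficients \<open>(p, q, r)\<close> of the binary form \<open>p x\<^sup>2 + 2 q x y + r y\<^sup>2\<close>: for \<open>1 < k < 7\<close> a multiple
  of \<open>\<bar>slope k v\<bar>\<^sup>2 - \<bar>v\<bar>\<^sup>2\<close>; the forms \<open>y\<^sup>2\<close> and \<open>x\<^sup>2\<close> single out the coordinate axes for the two
  pieces on which the deformation is a rigid motion.\<close>
definition slip_form :: "nat \<Rightarrow> real \<times> real \<times> real" where
  "slip_form k = [(0, 0, 0), (0, 0, 1), (1, 3, 4), (4, 3, 1), (4, 7, 6), (7, -2, -3), (-2, 1, 12), (1, 0, 0)] ! k"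

definition isotropic :: "real \<times> real \<times> real \<Rightarrow> real^2 \<Rightarrow> bool" where
  "isotropic S v \<longleftrightarrow> fst S * (v$1)^2 + 2 * fst (snd S) * v$1 * v$2 + snd (snd S) * (v$2)^2 = 0"

lemma isotropic_slip_form:
  "\<forall>k\<in>{1..7}. \<forall>v. (k = 1 \<longrightarrow> v = axis 1 1) \<and> (k = 7 \<longrightarrow> v = axis 2 1) \<and>
     norm v = 1 \<and> norm (slope k *v v) = 1 \<longrightarrow> isotropic (slip_form k) v"
  unfolding ball_1_7
  by (auto simp: isotropic_def slip_form_def slope_def matrix_vector_mult_22 norm_eq_1 inner_vec_def sum_2
      axis_def power2_eq_square algebra_simps)

text \<open>The resultant is nonzero for each of the 21 pairs of forms. Hence no two grains share a
  slip line, whichever zeros of their forms are selected.\<close>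

lemma slip_form_no_common_zero:
  "\<forall>k\<in>{1..7}. \<forall>l\<in>{1..7}. k < l \<longrightarrow>
     (\<forall>v. v \<noteq> 0 \<longrightarrow> \<not> (isotropic (slip_form k) v \<and> isotropic (slip_form l) v))"
proof -
  have "v = 0"
    if "isotropic S v" "isotropic T v"
      "(fst S * snd (snd T) - fst T * snd (snd S))^2 \<noteq>
        4 * (fst S * fst (snd T) - fst T * fst (snd S)) * (fst (snd S) * snd (snd T) - fst (snd T) * snd (snd S))"
    for v S T
  proof (rule ccontr)
    assume "v \<noteq> 0"
    then have "v$1 \<noteq> 0 \<or> v$2 \<noteq> 0" by (simp add: vec_eq_iff forall_2)
    from binary_forms_common_zero[OF this that(1,2)[unfolded isotropic_def]] that(3) show False
      by contradiction
  qed
  then show ?thesis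
    unfolding ball_1_7 by (intro conjI impI allI notI) (auto simp: slip_form_def)
qed

lemma isotropic_uminus: "isotropic S (- v) = isotropic S v"
  by (simp add: isotropic_def)

lemma slip_directions:
  obtains v :: "nat \<Rightarrow> real^2" where "\<And>k. norm (v k) = 1"
    "\<And>k. k \<in> {1..7} \<Longrightarrow> norm (slope k *v v k) = 1" "v 1 = axis 1 1" "v 7 = axis 2 1"
    "\<And>k l. k \<in> {1..7} \<Longrightarrow> l \<in> {1..7} \<Longrightarrow> k \<noteq> l \<Longrightarrow> v k \<noteq> v l \<and> v k \<noteq> - v l"
proof -
  have "\<exists>v. norm v = 1 \<and> (k \<in> {1..7} \<longrightarrow> norm (slope k *v v) = 1) \<and>
      (k = 1 \<longrightarrow> v = axis 1 1) \<and> (k = 7 \<longrightarrow> v = axis 2 1)" for k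
  \<comment> \<open>The gradients of grains 1 and 7 are rotations, so every unit vector keeps its
    length and the coordinate axes may be prescribed there.\<close>
  proof (cases "k = 1 \<or> k = 7")
    case True
    then show ?thesis
      by (auto simp: slope_def matrix_vector_mult_22 norm_eq_1 inner_vec_def sum_2 axis_def)
  next
    case False
    show ?thesis
    proof (cases "k \<in> {1..7}")
      case True
      then show ?thesis using isotropic_direction[of "slope k"] det_slope False by metis
    next
      case False': False
      \<comment> \<open>A dummy unit vector for indices that belong to no grain, so that
        \<open>norm (v k) = 1\<close> holds for every \<open>k\<close>.\<close>
      have "norm (axis 1 1 :: real^2) = 1" by simp
      then show ?thesis using False False' by blast
    qed
  qed
  then obtain v where v: "\<And>k. norm (v k) = 1" "\<And>k. k \<in> {1..7} \<Longrightarrow> norm (slope k *v v k) = 1"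
    "v 1 = axis 1 1" "v 7 = axis 2 1" by metis
  have iso: "isotropic (slip_form k) (v k)" if "k \<in> {1..7}" for k
    using isotropic_slip_form v that by metis
  have neq: "v k \<noteq> v l \<and> v k \<noteq> - v l" if kl: "k \<in> {1..7}" "l \<in> {1..7}" "k \<noteq> l" for k l
  proof -
    have "\<forall>w. w \<noteq> 0 \<longrightarrow> \<not> (isotropic (slip_form k) w \<and> isotropic (slip_form l) w)"
      by (rule ball_less_imp_ball_neq[OF slip_form_no_common_zero _ kl]) blast
    moreover have "v k \<noteq> 0" using v(1)[of k] by force
    \<comment> \<open>The forms are even, so both \<open>v k = v l\<close> and
      \<open>v k = - v l\<close> would make \<open>v k\<close> a common zero.\<close>
    ultimately show ?thesis using iso[OF kl(1)] iso[OF kl(2)] isotropic_uminus by metis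
  qed
  show ?thesis by (rule that[OF v neq])
qed

lemma rot_eq_iff: "rot v = rot w \<longleftrightarrow> v = w"
  by (auto simp: rot_def vec_eq_iff forall_2)

lemma uminus_rot: "- rot v = rot (- v)"
  by (simp add: rot_def vec_eq_iff forall_2)

text \<open>A combination of indicators of open sets, hence bounded and Borel on the whole plane;
  the value 0 outside the grains concerns only a null set of the triangle.\<close>

definition grain_gradient :: "real^2 \<Rightarrow> mat2" where
  "grain_gradient x = (\<Sum>k\<in>{1..7}. indicator (grain k) x *\<^sub>R slope k)"

lemma grain_gradient_eq:
  assumes "k \<in> {1..7}" "x \<in> grain k"
  shows "grain_gradient x = slope k"
proof -
  have "grain_gradient x = (\<Sum>l\<in>{1..7}. if l = k then slope k else 0)"
    unfolding grain_gradient_def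
  proof (rule sum.cong)
    fix l :: nat assume l: "l \<in> {1..7}"
    show "indicator (grain l) x *\<^sub>R slope l = (if l = k then slope k else 0)"
    proof (cases "l = k")
      case False
      then have "x \<notin> grain l" using grain_unique[OF l assms(1) _ assms(2)] by blast
      then show ?thesis using False by simp
    qed (simp add: assms(2))
  qed simp
  then show ?thesis using assms(1) by simp
qed

theorem proposition5p1:
  shows "\<exists>N G \<Omega> R. polycrystal N G \<Omega> R \<and> taylor_N N G R \<subset> attainable_M \<Omega> R"
proof -
  obtain v :: "nat \<Rightarrow> real^2" where v1: "\<And>k. norm (v k) = 1"
    and slope_v: "\<And>k. k \<in> {1..7} \<Longrightarrow> norm (slope k *v v k) = 1" and v17: "v 1 = axis 1 1" "v 7 = axis 2 1"
    and v_neq: "\<And>k l. k \<in> {1..7} \<Longrightarrow> l \<in> {1..7} \<Longrightarrow> k \<noteq> l \<Longrightarrow> v k \<noteq> v l \<and> v k \<noteq> - v l"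
    by (rule slip_directions) blast
  \<comment> \<open>At points of no grain \<open>THE\<close> yields an unspecified index, but every
    \<open>v k\<close> is a unit vector, so \<open>R x\<close> is still a rotation.\<close>
  define R where "R = (\<lambda>x. rot (v (THE k. k \<in> {1..7} \<and> x \<in> grain k)))"
  have R_grain: "R x = rot (v k)" if "k \<in> {1..7}" "x \<in> grain k" for k x
  proof -
    have "(THE k. k \<in> {1..7} \<and> x \<in> grain k) = k"
      using that grain_unique by (intro the_equality) blast+
    then show ?thesis by (simp add: R_def)
  qed
  have R_rot: "rotation_matrix (R x)" for x
    unfolding R_def by (rule rotation_matrix_rot[OF v1])

  have taylor_rot: "rotation_matrix F" if F: "F \<in> taylor_N 7 grain R" for F
  proof -
    have *: "det F = 1 \<and> norm (F *v v k) \<le> 1" if "k \<in> {1..7}" for k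
    proof -
      have "grain k \<noteq> {}" using grain_nonempty that by simp
      then obtain x where x: "x \<in> grain k" by blast
      then have "F \<in> rotated N_set (R x)" using F that by (auto simp: taylor_N_def)
      then show ?thesis using R_grain[OF that x] R_rot[of x] by (simp add: mem_rotated_N_iff rot_axis)
    qed
    \<comment> \<open>Grains 1 and 7 have the two coordinate axes as slip directions, so both
      columns of \<open>F\<close> have length at most 1.\<close>
    show ?thesis using *[of 1] *[of 7] v17 by (intro rotation_matrix_if_columns_le_1) auto
  qed
  have "taylor_N 7 grain R \<subseteq> attainable_M triangle R"
    by (rule subsetI, rule rotation_attainable_M[OF open_open_polygon bounded_triangle taylor_rot R_rot])

  moreover have "polycrystal 7 grain triangle R"
    unfolding polycrystal_def
  proof (intro conjI ballI impI)
    show "bounded_lipschitz_domain triangle" by (rule bounded_lipschitz_domain_grain) simp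
    show "bounded_lipschitz_domain (grain k)" if "k \<in> {1..7}" for k
      using that by (intro bounded_lipschitz_domain_grain) simp
    show "grain k \<subseteq> triangle" if "k \<in> {1..7}" for k
      using that grain_subset by blast
    show "interior (closure (grain k)) = grain k" for k
      by (simp add: convex_interior_closure convex_open_polygon interior_open open_open_polygon)
    show "disjoint_family_on grain {1..7}"
      using grain_unique by (fastforce simp: disjoint_family_on_def)
    show "negligible (triangle - \<Union> (grain ` {1..7}))" by (rule negligible_triangle_minus_grains)
    have "(\<Union>k\<in>{1..7}. closure (grain k)) = closure triangle"
      using Union_closed_grain closure_grain by simp
    then show "triangle = interior (\<Union>k\<in>{1..7}. closure (grain k))"
      by (simp add: convex_interior_closure convex_open_polygon interior_open open_open_polygon)
    show "rotation_matrix (R x)" for x by (rule R_rot)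
    show "R constant_on grain k" if "k \<in> {1..7}" for k
      using R_grain[OF that] by (auto simp: constant_on_def)
    fix k l x y assume "k \<in> {1..7}" "l \<in> {1..7}"
      "k \<noteq> l \<and> 0 < hausdorff1 (frontier (grain k) \<inter> frontier (grain l))"
      "x \<in> grain k" "y \<in> grain l"
    then show "R x \<noteq> R y" "R x \<noteq> - R y"
      using R_grain[of k x] R_grain[of l y] v_neq[of k l] by (auto simp: uminus_rot rot_eq_iff)
  qed

  moreover have "slope 0 \<in> attainable_M triangle R"
  proof -
    obtain L where L: "L-lipschitz_on UNIV deformation"
      by (rule lipschitz_on_piecewise_affine[of "{0..7}" piece deformation slope offset])
        (use closed_piece Union_piece deformation_eq in auto)
    show ?thesis
    proof (rule attainable_MI[OF open_open_polygon bounded_triangle L])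
      show "grain_gradient \<in> borel_measurable borel"
        unfolding grain_gradient_def by (intro borel_measurable_sum borel_measurable_scaleR
            borel_measurable_indicator borel_measurable_const) (simp add: open_open_polygon)
      show "norm (grain_gradient x) \<le> (\<Sum>k\<in>{1..7}. norm (slope k))" for x
        unfolding grain_gradient_def by (rule sum_norm_le) (simp add: indicator_def)
      show "AE x in lborel. x \<in> triangle \<longrightarrow>
          (deformation has_derivative (*v) (grain_gradient x)) (at x) \<and>
          grain_gradient x \<in> rotated M_set (R x)"
        using AE_grain
      proof eventually_elim
        case (elim x)
        have "(deformation has_derivative (*v) (grain_gradient x)) (at x) \<and>
            grain_gradient x \<in> rotated M_set (R x)" if k: "k \<in> {1..7}" "x \<in> grain k" for k
          using deformation_has_derivative[OF k] grain_gradient_eq[OF k] R_grain[OF k] R_rot[of x]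
            det_slope slope_v[OF k(1)] k(1)
          by (simp add: mem_rotated_M_iff rot_axis)
        then show ?case using elim by blast
      qed
      show "deformation x = slope 0 *v x" if "x \<in> frontier triangle" for x
      proof -
        \<comment> \<open>The triangle is open, so its frontier lies in the complement, where the
          deformation is the shear.\<close>
        have "x \<in> piece 0"
          using that by (simp add: piece_def frontier_def interior_open open_open_polygon)
        moreover have "offset 0 = 0" by (simp add: offset_def vec_eq_iff forall_2)
        ultimately show ?thesis using deformation_eq[of 0 x] by simp
      qed
    qed
  qed
  moreover have "slope 0 \<notin> taylor_N 7 grain R"
  proof
    assume "slope 0 \<in> taylor_N 7 grain R"
    \<comment> \<open>Members of the Taylor bound are rotations, whereas the shear maps the second
      basis vector to (1, 1).\<close>
    then have "norm (slope 0 *v axis 2 1) = 1"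
      using rotation_matrix_norm[OF taylor_rot] norm_axis_1 by metis
    then show False
      unfolding norm_eq_1 by (simp add: slope_def matrix_vector_mult_22 inner_vec_def sum_2 axis_def)
  qed
  ultimately show ?thesis by (intro exI conjI psubsetI) auto
qed

end
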